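(* Let $n\ge1$ be an integer and let $\phi:\mathbb{R}\to\mathbb{R}$ be a sigmoid, ReLU, ELU, Softplus, or LeakyReLU. Then for every $p$ with $1\le p<\infty$: $$\mathcal{S}_{n+2}(\phi)\cap L^p(\mathbb{R}^2\times[0,1]^n)=\{0\},$$ $$\mathcal{S}_{n+1}(\phi)\cap L^p(\mathbb{R}^{n+1})=\{0\},$$ $$\mathcal{S}_{n+1}(\phi)\cap L^p\big(\{(x_0,\ldots,x_n)\in\mathbb{R}^{n+1}: x_1^2+\cdots+x_n^2>x_0\}\big)=\{0\}.$$ Here each equality is in the corresponding $L^p$ space: any function in $\mathcal{S}_m(\phi)$ whose restriction to the domain is in $L^p$ of the domain is zero almost everywhere on that domain.
   Context: For a function $\phi:\mathbb{R}\to\mathbb{R}$ and an integer $m\ge1$, $\mathcal{S}_m(\phi)$ denotes the set of all functions on $\mathbb{R}^m$ of the form $x\mapsto\sum_{i=1}^k t_i\,\phi(\langle y_i,x\rangle+\varrho_i)$ with $k\in\mathbb{N}$, $t_i,\varrho_i\in\mathbb{R}$, $y_i\in\mathbb{R}^m$ (dot product $\langle\cdot,\cdot\rangle$). $L^p$ spaces are with respect to Lebesgue measure. Activation functions: a sigmoid is a real-valued function $\phi$ on $\mathbb{R}$ with $\phi(t)\to1$ as $t\to+\infty$ and $\phi(t)\to0$ as $t\to-\infty$; $\mathrm{ReLU}(x)=x$ if $x>0$ and $0$ if $x\le0$; $\mathrm{ELU}(x)=x$ if $x>0$ and $\alpha(e^x-1)$ if $x\le 0$, with $\alpha$ a real parameter;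 $\mathrm{Softplus}(x)=\log(e^x+1)$; $\mathrm{LeakyReLU}(x)=x$ if $x>0$ and $\alpha x$ if $x\le0$, with $\alpha$ a real parameter, $\alpha\ne1$. *)

theory Defs
  imports "HOL-Analysis.Analysis"
begin

text \<open>
  The space \<open>\<real>\<^sup>m\<close> is rendered by an arbitrary Euclidean space of dimension \<open>m\<close>; for
  products such as \<^typ>\<open>real \<times> (real ^ 'n)\<close> the inner product and the Lebesgue measure are the
  standard ones in the joint coordinates.
\<close>

definition shallow_nets :: "(real \<Rightarrow> real) \<Rightarrow> ('a::euclidean_space \<Rightarrow> real) set" where
  "shallow_nets \<phi> =
     {f. \<exists>(k::nat) t y \<rho>. f = (\<lambda>x. \<Sum>i<k. t i * \<phi> (y i \<bullet> x + \<rho> i))}"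

text \<open>A sigmoid is not required to be measurable, continuous or monotone.\<close>

definition sigmoid :: "(real \<Rightarrow> real) \<Rightarrow> bool" where
  "sigmoid \<phi> \<longleftrightarrow> (\<phi> \<longlongrightarrow> 1) at_top \<and> (\<phi> \<longlongrightarrow> 0) at_bot"

definition relu :: "real \<Rightarrow> real" where
  "relu x = (if x > 0 then x else 0)"

definition elu :: "real \<Rightarrow> real \<Rightarrow> real" where
  "elu \<alpha> x = (if x > 0 then x else \<alpha> * (exp x - 1))"

definition softplus :: "real \<Rightarrow> real" where
  "softplus x = ln (exp x + 1)"

definition leaky_relu :: "real \<Rightarrow> real \<Rightarrow> real" where
  "leaky_relu \<alpha> x = (if x > 0 then x else \<alpha> * x)"

text \<open>
  Functions on the whole space whose restriction to \<open>\<Omega>\<close> is \<open>p\<close>-integrable; the values outside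
  \<open>\<Omega>\<close> are irrelevant. Measurability of \<open>f\<close> has to be demanded separately, since it does not
  follow from that of \<open>\<bar>f\<bar>\<^sup>p\<close>.
\<close>

definition Lp_fun :: "real \<Rightarrow> 'a::euclidean_space set \<Rightarrow> ('a \<Rightarrow> real) set" where
  "Lp_fun p \<Omega> =
     {f. f \<in> borel_measurable (lebesgue_on \<Omega>) \<and>
         integrable (lebesgue_on \<Omega>) (\<lambda>x. \<bar>f x\<bar> powr p)}"

text \<open>The element of the space \<open>L\<^sup>p(\<Omega>)\<close> represented by \<open>f\<close>, i.e. its class modulo equality almost
  everywhere on \<open>\<Omega>\<close>.\<close>

definition Lp_class :: "real \<Rightarrow> 'a::euclidean_space set \<Rightarrow> ('a \<Rightarrow> real) \<Rightarrow> ('a \<Rightarrow> real) set" where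
  "Lp_class p \<Omega> f = {g \<in> Lp_fun p \<Omega>. AE x in lebesgue_on \<Omega>. g x = f x}"

text \<open>The intersection \<open>S(\<phi>) \<inter> L\<^sup>p(\<Omega>)\<close> as a subset of the space \<open>L\<^sup>p(\<Omega>)\<close>.\<close>

definition nets_in_Lp ::
    "(real \<Rightarrow> real) \<Rightarrow> real \<Rightarrow> 'a::euclidean_space set \<Rightarrow> ('a \<Rightarrow> real) set set" where
  "nets_in_Lp \<phi> p \<Omega> = Lp_class p \<Omega> ` (shallow_nets \<phi> \<inter> Lp_fun p \<Omega>)"

definition strip :: "((real ^ 2) \<times> (real ^ 'n)) set" where
  "strip = UNIV \<times> {x. \<forall>i. 0 \<le> x $ i \<and> x $ i \<le> 1}"

definition paraboloid_exterior :: "(real \<times> (real ^ 'n)) set" where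
  "paraboloid_exterior = {(x0, x). (\<Sum>i\<in>UNIV. (x $ i)\<^sup>2) > x0}"

end

theory Submission
  imports Defs "HOL-Real_Asymp.Real_Asymp"
begin

text \<open>
  All the activation functions are asymptotically affine at both ends. Moving a function of
  \<open>L\<^sup>p(\<Omega>)\<close> along the integer multiples of a vector \<open>v\<close> that eventually stay in \<open>\<Omega>\<close> gives a
  sequence tending to 0 almost everywhere. For a network, the nodes whose weight is not orthogonal
  to \<open>v\<close> become affine in this limit, so the sum of the remaining nodes is affine almost everywhere on
  \<open>\<Omega>\<close>. If the admissible \<open>v\<close> fill a plane \<open>W\<close> up to sign, then the nodes can be grouped by the
  line spanned by the projection of their weight to \<open>W\<close>, and choosing \<open>v\<close> orthogonal to that line
  shows that each group is affine. Hence so is the network, and an affine function tending to 0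
  along \<open>x + k v\<close> vanishes at \<open>x\<close>.
\<close>

section \<open>Decay of integrable functions along a translation\<close>

lemma lebesgue_measurable_translation:
  "(+) c \<in> lebesgue \<rightarrow>\<^sub>M (lebesgue :: 'a::euclidean_space measure)"
  using lebesgue_affine_measurable[of "\<lambda>_. 1" c] by (simp add: euclidean_representation)

lemma lebesgue_distr_translation:
  "distr lebesgue lebesgue ((+) c) = (lebesgue :: 'a::euclidean_space measure)"
proof -
  have "(lebesgue :: 'a measure) = density (distr lebesgue lebesgue ((+) c)) (\<lambda>_. 1)"
    using lebesgue_affine_euclidean[of "\<lambda>_. 1" c] by (simp add: euclidean_representation)
  then show ?thesis by (simp add: density_1)
qed

lemma nn_integral_lebesgue_translation:
  fixes h :: "'a::euclidean_space \<Rightarrow> ennreal"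
  assumes "h \<in> borel_measurable lebesgue"
  shows "(\<integral>\<^sup>+x. h (c + x) \<partial>lebesgue) = (\<integral>\<^sup>+x. h x \<partial>lebesgue)"
proof -
  have "(\<integral>\<^sup>+x. h x \<partial>lebesgue) = (\<integral>\<^sup>+x. h x \<partial>distr lebesgue lebesgue ((+) c))"
    by (simp add: lebesgue_distr_translation)
  also have "\<dots> = (\<integral>\<^sup>+x. h (c + x) \<partial>lebesgue)"
    by (rule nn_integral_distr) (auto simp: lebesgue_measurable_translation assms)
  finally show ?thesis by simp
qed

lemma AE_lebesgue_translation:
  fixes c :: "'a::euclidean_space"
  assumes "AE x in lebesgue. P x"
  shows "AE x in lebesgue. P (c + x)"
proof -
  have "AE x in distr lebesgue lebesgue ((+) c). P x"
    using assms by (subst lebesgue_distr_translation)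
  then show ?thesis
    by (rule AE_distrD[OF lebesgue_measurable_translation])
qed

text \<open>
  Each slab \<open>\<lfloor>(x \<bullet> v) / (v \<bullet> v)\<rfloor> = j\<close> is disjoint from its translates by multiples of \<open>v\<close>, so
  \<open>\<Sum>k. h (x + k v)\<close> is integrable over it.
\<close>

lemma integrable_translates_tendsto_0:
  fixes h :: "'a::euclidean_space \<Rightarrow> real"
  assumes h: "integrable lebesgue h" and nonneg: "\<And>x. 0 \<le> h x" and v: "v \<noteq> 0"
  shows "AE x in lebesgue. (\<lambda>k. h (x + real k *\<^sub>R v)) \<longlonglongrightarrow> 0"
proof -
  define slab where "slab x = \<lfloor>(x \<bullet> v) / (v \<bullet> v)\<rfloor>" for x
  have slab_shift: "slab (real k *\<^sub>R v + x) = slab x + int k" for k x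
  proof -
    have "((real k *\<^sub>R v + x) \<bullet> v) / (v \<bullet> v) = (x \<bullet> v) / (v \<bullet> v) + of_int (int k)"
      using v by (simp add: inner_add_left add_divide_distrib)
    then show ?thesis
      unfolding slab_def by (simp only: floor_add_int)
  qed
  define B where "B j = {x. slab x = j}" for j
  have B_meas [measurable]: "B j \<in> sets lebesgue" for j
  proof -
    have "B j \<in> sets borel"
      unfolding B_def slab_def by measurable
    then show ?thesis by simp
  qed
  define H where "H x = ennreal (h x)" for x
  have H_meas [measurable]: "H \<in> borel_measurable lebesgue"
    unfolding H_def using borel_measurable_integrable[OF h] by measurable
  have H_finite: "(\<integral>\<^sup>+x. H x \<partial>lebesgue) < \<infinity>"
    using h nonneg unfolding H_def by (simp add: integrable_iff_bounded)
  have shifted_meas [measurable]: "(\<lambda>x. H (real k *\<^sub>R v + x)) \<in> borel_measurable lebesgue" for k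
    using measurable_compose[OF lebesgue_measurable_translation H_meas] .
  have "AE x in lebesgue. x \<in> B j \<longrightarrow> (\<lambda>k. h (x + real k *\<^sub>R v)) \<longlonglongrightarrow> 0" for j
  proof -
    have "(\<integral>\<^sup>+x. (\<Sum>k. H (real k *\<^sub>R v + x) * indicator (B j) x) \<partial>lebesgue)
        = (\<Sum>k. \<integral>\<^sup>+x. H (real k *\<^sub>R v + x) * indicator (B j) x \<partial>lebesgue)"
      by (rule nn_integral_suminf) measurable
    \<comment> \<open>Translation by \<open>real k *\<^sub>R v\<close> carries slab \<open>j\<close>
      to slab \<open>j + int k\<close>, so the integrals of the translates over one slab become
      integrals of \<open>H\<close> itself over distinct slabs.\<close>
    also have "\<dots> = (\<Sum>k. \<integral>\<^sup>+x. H x * indicator (B (j + int k)) x \<partial>lebesgue)"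
    proof (rule suminf_cong)
      fix k
      have "(\<integral>\<^sup>+x. H (real k *\<^sub>R v + x) * indicator (B j) x \<partial>lebesgue)
          = (\<integral>\<^sup>+x. (\<lambda>y. H y * indicator (B (j + int k)) y) (real k *\<^sub>R v + x) \<partial>lebesgue)"
        by (intro nn_integral_cong) (auto simp: B_def slab_shift indicator_def)
      also have "\<dots> = (\<integral>\<^sup>+x. H x * indicator (B (j + int k)) x \<partial>lebesgue)"
        by (rule nn_integral_lebesgue_translation) measurable
      finally show "(\<integral>\<^sup>+x. H (real k *\<^sub>R v + x) * indicator (B j) x \<partial>lebesgue)
          = (\<integral>\<^sup>+x. H x * indicator (B (j + int k)) x \<partial>lebesgue)" .
    qed
    also have "\<dots> = (\<integral>\<^sup>+x. (\<Sum>k. H x * indicator (B (j + int k)) x) \<partial>lebesgue)"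
      by (rule nn_integral_suminf[symmetric]) measurable
    also have "\<dots> \<le> (\<integral>\<^sup>+x. H x \<partial>lebesgue)"
    proof (rule nn_integral_mono)
      fix x :: 'a
      have disj: "disjoint_family (\<lambda>k. B (j + int k))"
        by (auto simp: disjoint_family_on_def B_def)
      have "(\<Sum>k. H x * indicator (B (j + int k)) x) = H x * (\<Sum>k. indicator (B (j + int k)) x)"
        by (simp add: ennreal_suminf_cmult)
      also have "\<dots> = H x * indicator (\<Union>k. B (j + int k)) x"
        using suminf_indicator[OF disj] by simp
      also have "\<dots> \<le> H x"
        by (auto simp: indicator_def)
      finally show "(\<Sum>k. H x * indicator (B (j + int k)) x) \<le> H x" .
    qed
    finally have "(\<integral>\<^sup>+x. (\<Sum>k. H (real k *\<^sub>R v + x) * indicator (B j) x) \<partial>lebesgue) \<noteq> \<infinity>"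
      using H_finite by (auto simp: top_unique)
    \<comment> \<open>A finite integral forces the sum to be finite almost everywhere, and the terms
      of a convergent series tend to 0.\<close>
    then have "AE x in lebesgue. (\<Sum>k. H (real k *\<^sub>R v + x) * indicator (B j) x) \<noteq> \<infinity>"
      by (intro nn_integral_PInf_AE) measurable
    then show ?thesis
    proof (rule AE_mp, intro AE_I2 impI)
      fix x
      assume fin: "(\<Sum>k. H (real k *\<^sub>R v + x) * indicator (B j) x) \<noteq> \<infinity>" and "x \<in> B j"
      then have "(\<Sum>k. ennreal (h (x + real k *\<^sub>R v))) \<noteq> top"
        by (simp add: H_def add.commute)
      then have "summable (\<lambda>k. h (x + real k *\<^sub>R v))"
        by (intro summable_suminf_not_top nonneg)
      then show "(\<lambda>k. h (x + real k *\<^sub>R v)) \<longlonglongrightarrow> 0"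
        by (rule summable_LIMSEQ_zero)
    qed
  qed
  \<comment> \<open>The slabs cover the space and are countably many, so their exceptional null sets
    have a null union.\<close>
  then have "AE x in lebesgue. \<forall>j. x \<in> B j \<longrightarrow> (\<lambda>k. h (x + real k *\<^sub>R v)) \<longlonglongrightarrow> 0"
    unfolding AE_all_countable by blast
  then show ?thesis
    by (rule AE_mp) (auto simp: B_def)
qed

text \<open>The threshold for \<open>k\<close> may depend on the point: in the exterior of a
  paraboloid a point can leave the domain for small \<open>k\<close> and return later.\<close>

definition recession_vector :: "'a::euclidean_space set \<Rightarrow> 'a \<Rightarrow> bool" where
  "recession_vector \<Omega> v \<longleftrightarrow> v \<noteq> 0 \<and> (\<forall>x\<in>\<Omega>. \<forall>\<^sub>F k in sequentially. x + real k *\<^sub>R v \<in> \<Omega>)"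

text \<open>The decay result is applied to \<open>\<bar>f x\<bar> powr p\<close> extended by 0
  outside \<Omega>. The orbit of a point of \<Omega> is eventually inside \<Omega>, where the root
  of order \<open>p\<close> recovers the absolute value of \<open>f\<close>.\<close>

lemma Lp_fun_tendsto_0:
  fixes f :: "'a::euclidean_space \<Rightarrow> real"
  assumes f: "f \<in> Lp_fun p \<Omega>" and \<Omega>: "\<Omega> \<in> sets lebesgue" and v: "recession_vector \<Omega> v"
    and p: "0 < p"
  shows "AE x in lebesgue. x \<in> \<Omega> \<longrightarrow> (\<lambda>k. f (x + real k *\<^sub>R v)) \<longlonglongrightarrow> 0"
proof -
  define h where "h x = indicator \<Omega> x * \<bar>f x\<bar> powr p" for x
  have "integrable lebesgue h"
    using f \<Omega> integrable_restrict_space[of \<Omega> lebesgue "\<lambda>x. \<bar>f x\<bar> powr p"]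
    unfolding Lp_fun_def h_def by auto
  then have "AE x in lebesgue. (\<lambda>k. h (x + real k *\<^sub>R v)) \<longlonglongrightarrow> 0"
    by (rule integrable_translates_tendsto_0) (use v in \<open>auto simp: h_def recession_vector_def\<close>)
  then show ?thesis
  proof (rule AE_mp, intro AE_I2 impI)
    fix x
    assume lim: "(\<lambda>k. h (x + real k *\<^sub>R v)) \<longlonglongrightarrow> 0" and "x \<in> \<Omega>"
    then have ev: "\<forall>\<^sub>F k in sequentially. x + real k *\<^sub>R v \<in> \<Omega>"
      using v by (auto simp: recession_vector_def)
    have "(\<lambda>k. h (x + real k *\<^sub>R v) powr (1/p)) \<longlonglongrightarrow> 0 powr (1/p)"
      using lim p by (intro tendsto_powr2) (auto simp: h_def)
    then have "(\<lambda>k. h (x + real k *\<^sub>R v) powr (1/p)) \<longlonglongrightarrow> 0"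
      by simp
    moreover have "\<forall>\<^sub>F k in sequentially. h (x + real k *\<^sub>R v) powr (1/p) = \<bar>f (x + real k *\<^sub>R v)\<bar>"
      using ev p by (auto elim!: eventually_mono simp: h_def powr_powr)
    ultimately have "(\<lambda>k. \<bar>f (x + real k *\<^sub>R v)\<bar>) \<longlonglongrightarrow> 0"
      by (rule Lim_transform_eventually)
    then show "(\<lambda>k. f (x + real k *\<^sub>R v)) \<longlonglongrightarrow> 0"
      by (rule tendsto_rabs_zero_cancel)
  qed
qed

text \<open>Consecutive terms differ by \<open>d\<close>, so convergence forces \<open>d = 0\<close>
  and the sequence is constant.\<close>

lemma affine_sequence_tendsto_0:
  fixes a d :: real
  assumes "(\<lambda>k. a + real k * d) \<longlonglongrightarrow> 0"
  shows "a = 0"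
proof -
  have "(\<lambda>k. (a + real (Suc k) * d) - (a + real k * d)) \<longlonglongrightarrow> 0 - 0"
    by (intro tendsto_diff assms LIMSEQ_Suc[OF assms])
  then have "(\<lambda>_::nat. d) \<longlonglongrightarrow> 0"
    by (simp add: algebra_simps)
  then have "d = 0"
    by (simp add: LIMSEQ_const_iff)
  with assms show ?thesis
    by (simp add: LIMSEQ_const_iff)
qed

section \<open>Networks with an asymptotically affine activation function\<close>

text \<open>This is the common property of all the activation functions. The asymptotes at the two
  ends may differ.\<close>

definition asymp_affine :: "(real \<Rightarrow> real) \<Rightarrow> bool" where
  "asymp_affine \<phi> \<longleftrightarrow> (\<exists>a b. ((\<lambda>t. \<phi> t - (a * t + b)) \<longlongrightarrow> 0) at_top) \<and>
                     (\<exists>a b. ((\<lambda>t. \<phi> t - (a * t + b)) \<longlongrightarrow> 0) at_bot)"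

text \<open>The null set lives in the whole space, with membership in \<Omega> as a premise, so that
  it can be translated freely.\<close>

definition affine_on_AE :: "'a::euclidean_space set \<Rightarrow> ('a \<Rightarrow> real) \<Rightarrow> bool" where
  "affine_on_AE \<Omega> f \<longleftrightarrow> (\<exists>l c. AE x in lebesgue. x \<in> \<Omega> \<longrightarrow> f x = l \<bullet> x + c)"

section \<open>Sums and differences of functions affine almost everywhere\<close>

lemma affine_on_AE_diff:
  assumes "affine_on_AE \<Omega> f" "affine_on_AE \<Omega> g"
  shows "affine_on_AE \<Omega> (\<lambda>x. f x - g x)"
proof -
  obtain l c m d where "AE x in lebesgue. x \<in> \<Omega> \<longrightarrow> f x = l \<bullet> x + c"
    and "AE x in lebesgue. x \<in> \<Omega> \<longrightarrow> g x = m \<bullet> x + d"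
    using assms unfolding affine_on_AE_def by blast
  then have "AE x in lebesgue. x \<in> \<Omega> \<longrightarrow> f x - g x = (l - m) \<bullet> x + (c - d)"
    by eventually_elim (auto simp: inner_diff_left)
  then show ?thesis
    unfolding affine_on_AE_def by blast
qed

lemma affine_on_AE_const: "affine_on_AE \<Omega> (\<lambda>_. c)"
  unfolding affine_on_AE_def by (intro exI[of _ 0] exI[of _ c]) simp

lemma affine_on_AE_add:
  assumes "affine_on_AE \<Omega> f" "affine_on_AE \<Omega> g"
  shows "affine_on_AE \<Omega> (\<lambda>x. f x + g x)"
  using affine_on_AE_diff[OF assms(1) affine_on_AE_diff[OF affine_on_AE_const assms(2)], of 0]
  by simp

lemma affine_on_AE_sum:
  assumes "\<And>i. i \<in> I \<Longrightarrow> affine_on_AE \<Omega> (f i)"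
  shows "affine_on_AE \<Omega> (\<lambda>x. \<Sum>i\<in>I. f i x)"
  using assms
  by (induction I rule: infinite_finite_induct) (auto intro: affine_on_AE_const affine_on_AE_add)

lemma affine_on_AE_Lp_fun_eq_0:
  fixes f :: "'a::euclidean_space \<Rightarrow> real"
  assumes f: "f \<in> Lp_fun p \<Omega>" "affine_on_AE \<Omega> f" and \<Omega>: "\<Omega> \<in> sets lebesgue"
    and v: "recession_vector \<Omega> v" and p: "0 < p"
  shows "AE x in lebesgue. x \<in> \<Omega> \<longrightarrow> f x = 0"
proof -
  obtain l c where lc: "AE x in lebesgue. x \<in> \<Omega> \<longrightarrow> f x = l \<bullet> x + c"
    using f(2) unfolding affine_on_AE_def by blast
  \<comment> \<open>Countably many translates of one null set are discarded, so the affine formula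
    holds along the whole orbit of almost every \<open>x\<close>; there it is affine in
    \<open>k\<close>.\<close>
  have "AE x in lebesgue. \<forall>k. x + real k *\<^sub>R v \<in> \<Omega> \<longrightarrow>
      f (x + real k *\<^sub>R v) = (l \<bullet> x + c) + real k * (l \<bullet> v)"
    unfolding AE_all_countable
  proof
    fix k
    show "AE x in lebesgue. x + real k *\<^sub>R v \<in> \<Omega> \<longrightarrow>
        f (x + real k *\<^sub>R v) = (l \<bullet> x + c) + real k * (l \<bullet> v)"
      using AE_lebesgue_translation[OF lc, of "real k *\<^sub>R v"]
      by (simp add: inner_add_right ac_simps)
  qed
  with Lp_fun_tendsto_0[OF f(1) \<Omega> v p] lc show ?thesis
  proof eventually_elim
    case (elim x)
    show ?case
    proof
      assume x: "x \<in> \<Omega>"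
      then have "\<forall>\<^sub>F k in sequentially. x + real k *\<^sub>R v \<in> \<Omega>"
        using v by (auto simp: recession_vector_def)
      then have "\<forall>\<^sub>F k in sequentially.
          f (x + real k *\<^sub>R v) = (l \<bullet> x + c) + real k * (l \<bullet> v)"
        by (rule eventually_mono) (use elim(3) in blast)
      then have "(\<lambda>k. (l \<bullet> x + c) + real k * (l \<bullet> v)) \<longlonglongrightarrow> 0"
        using elim(1) x by (auto intro: Lim_transform_eventually)
      then have "l \<bullet> x + c = 0"
        by (rule affine_sequence_tendsto_0)
      then show "f x = 0"
        using elim(2) x by simp
    qed
  qed
qed

text \<open>The nodes constant along \<open>v\<close> are the only ones that do not become affine in the limit.\<close>

lemma affine_on_AE_nodes_orthogonal:
  fixes y :: "nat \<Rightarrow> 'a::euclidean_space"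
  assumes f: "(\<lambda>x. \<Sum>i<n. t i * \<phi> (y i \<bullet> x + \<rho> i)) \<in> Lp_fun p \<Omega>"
    and \<phi>: "asymp_affine \<phi>" and \<Omega>: "\<Omega> \<in> sets lebesgue"
    and v: "recession_vector \<Omega> v" and p: "0 < p"
  shows "affine_on_AE \<Omega> (\<lambda>x. \<Sum>i | i < n \<and> y i \<bullet> v = 0. t i * \<phi> (y i \<bullet> x + \<rho> i))"
proof -
  define Z where "Z = {i. i < n \<and> y i \<bullet> v = 0}"
  define N where "N = {i. i < n \<and> y i \<bullet> v \<noteq> 0}"
  have split: "{..<n} = Z \<union> N" "Z \<inter> N = {}" "finite Z" "finite N"
    by (auto simp: Z_def N_def)
  obtain a b a' b' where top: "((\<lambda>t. \<phi> t - (a * t + b)) \<longlongrightarrow> 0) at_top"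
    and bot: "((\<lambda>t. \<phi> t - (a' * t + b')) \<longlongrightarrow> 0) at_bot"
    using \<phi> unfolding asymp_affine_def by blast
  \<comment> \<open>\<open>A i\<close> and \<open>C i\<close> are slope and intercept of the
    asymptote at the end to which the argument of node \<open>i\<close> runs, as decided by the sign
    of \<open>y i \<bullet> v\<close>.\<close>
  define A where "A i = (if y i \<bullet> v > 0 then a else a')" for i
  define C where "C i = (if y i \<bullet> v > 0 then b else b')" for i
  define arg where "arg i x k = y i \<bullet> x + \<rho> i + real k * (y i \<bullet> v)" for i x k
  have arg: "y i \<bullet> (x + real k *\<^sub>R v) + \<rho> i = arg i x k" for i x k
    by (simp add: arg_def inner_add_right)
  have lim: "(\<lambda>k. \<phi> (arg i x k) - (A i * arg i x k + C i)) \<longlonglongrightarrow> 0" if "i \<in> N" for i x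
  proof (cases "y i \<bullet> v > 0")
    case True
    then have "filterlim (\<lambda>k. arg i x k) at_top sequentially"
      unfolding arg_def by real_asymp
    from filterlim_compose[OF top this] show ?thesis
      using True by (simp add: A_def C_def)
  next
    case False
    with that have "y i \<bullet> v < 0"
      by (auto simp: N_def)
    then have "filterlim (\<lambda>k. arg i x k) at_bot sequentially"
      unfolding arg_def by real_asymp
    from filterlim_compose[OF bot this] show ?thesis
      using False by (simp add: A_def C_def)
  qed
  \<comment> \<open>At \<open>x + real k *\<^sub>R v\<close> the asymptotes of the nodes in
    \<open>N\<close>, weighted by \<open>t i\<close>, add up to
    \<open>l \<bullet> x + c + real k * d\<close>.\<close>
  define l where "l = (\<Sum>i\<in>N. (t i * A i) *\<^sub>R y i)"
  define c where "c = (\<Sum>i\<in>N. t i * (A i * \<rho> i + C i))"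
  define d where "d = (\<Sum>i\<in>N. t i * A i * (y i \<bullet> v))"
  define F where "F x = (\<Sum>i\<in>Z. t i * \<phi> (y i \<bullet> x + \<rho> i))" for x
  have "AE x in lebesgue. x \<in> \<Omega> \<longrightarrow>
      (\<lambda>k. \<Sum>i<n. t i * \<phi> (y i \<bullet> (x + real k *\<^sub>R v) + \<rho> i)) \<longlonglongrightarrow> 0"
    using Lp_fun_tendsto_0[OF f \<Omega> v p] .
  then have "AE x in lebesgue. x \<in> \<Omega> \<longrightarrow> F x = (- l) \<bullet> x + (- c)"
  proof (rule AE_mp, intro AE_I2 impI)
    fix x
    assume "x \<in> \<Omega> \<longrightarrow> (\<lambda>k. \<Sum>i<n. t i * \<phi> (y i \<bullet> (x + real k *\<^sub>R v) + \<rho> i)) \<longlonglongrightarrow> 0" and "x \<in> \<Omega>"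
    then have net: "(\<lambda>k. \<Sum>i<n. t i * \<phi> (arg i x k)) \<longlonglongrightarrow> 0"
      by (simp add: arg)
    have "(\<lambda>k. \<Sum>i\<in>N. t i * (\<phi> (arg i x k) - (A i * arg i x k + C i))) \<longlonglongrightarrow> (\<Sum>i\<in>N. t i * 0)"
      by (intro tendsto_sum tendsto_mult_left lim)
    from tendsto_diff[OF net this]
    have "(\<lambda>k. (\<Sum>i<n. t i * \<phi> (arg i x k))
        - (\<Sum>i\<in>N. t i * (\<phi> (arg i x k) - (A i * arg i x k + C i)))) \<longlonglongrightarrow> 0"
      by simp
    \<comment> \<open>For nodes in \<open>Z\<close> the argument does not depend on
      \<open>k\<close>, so they contribute \<open>F x\<close>; subtracting the vanishing remainders
      replaces each node in \<open>N\<close> by its asymptote.\<close>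
    moreover have "(\<Sum>i<n. t i * \<phi> (arg i x k))
        - (\<Sum>i\<in>N. t i * (\<phi> (arg i x k) - (A i * arg i x k + C i)))
        = (F x + l \<bullet> x + c) + real k * d" for k
    proof -
      have "(\<Sum>i<n. t i * \<phi> (arg i x k)) = F x + (\<Sum>i\<in>N. t i * \<phi> (arg i x k))"
        unfolding split(1) F_def using split
        by (subst sum.union_disjoint) (auto simp: arg_def Z_def)
      moreover have "(\<Sum>i\<in>N. t i * (A i * arg i x k + C i)) = l \<bullet> x + c + real k * d"
        by (simp add: l_def c_def d_def arg_def inner_sum_left sum_distrib_left
            sum.distrib[symmetric] algebra_simps)
      ultimately show ?thesis
        by (simp add: right_diff_distrib sum_subtractf)
    qed
    ultimately have "(\<lambda>k. (F x + l \<bullet> x + c) + real k * d) \<longlonglongrightarrow> 0"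
      by simp
    then have "F x + l \<bullet> x + c = 0"
      by (rule affine_sequence_tendsto_0)
    then show "F x = (- l) \<bullet> x + (- c)"
      by simp
  qed
  then show ?thesis
    unfolding affine_on_AE_def F_def Z_def by blast
qed

text \<open>Only the projections of the weights to the plane matter, recorded by \<open>u i\<close>
  and \<open>w i\<close>. A sign in \<open>plane\<close> suffices because \<open>v\<close> and
  \<open>- v\<close> are orthogonal to the same weights.\<close>

lemma shallow_net_in_Lp_eq_0:
  fixes \<Omega> :: "'a::euclidean_space set"
  assumes f: "f \<in> shallow_nets \<phi>" "f \<in> Lp_fun p \<Omega>"
    and \<phi>: "asymp_affine \<phi>" and \<Omega>: "\<Omega> \<in> sets lebesgue" and p: "0 < p"
    and plane: "\<And>a b. (a, b) \<noteq> (0, 0) \<Longrightarrow>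
      recession_vector \<Omega> (a *\<^sub>R e + b *\<^sub>R e') \<or> recession_vector \<Omega> (- (a *\<^sub>R e + b *\<^sub>R e'))"
  shows "AE x in lebesgue. x \<in> \<Omega> \<longrightarrow> f x = 0"
proof -
  obtain n t y \<rho> where f_eq: "f = (\<lambda>x. \<Sum>i<(n::nat). t i * \<phi> (y i \<bullet> x + \<rho> i))"
    using f(1) unfolding shallow_nets_def by auto
  define g where "g i x = t i * \<phi> (y i \<bullet> x + \<rho> i)" for i x
  define orth where "orth a b = {i. i < n \<and> y i \<bullet> (a *\<^sub>R e + b *\<^sub>R e') = 0}" for a b
  have orth_affine: "affine_on_AE \<Omega> (\<lambda>x. \<Sum>i\<in>orth a b. g i x)" if "(a, b) \<noteq> (0, 0)" for a b
  proof -
    from plane[OF that] obtain v where "recession_vector \<Omega> v"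
      and v: "v = a *\<^sub>R e + b *\<^sub>R e' \<or> v = - (a *\<^sub>R e + b *\<^sub>R e')"
      by blast
    then have "affine_on_AE \<Omega> (\<lambda>x. \<Sum>i | i < n \<and> y i \<bullet> v = 0. g i x)"
      using f(2) \<phi> \<Omega> p unfolding f_eq g_def by (intro affine_on_AE_nodes_orthogonal) auto
    moreover have "{i. i < n \<and> y i \<bullet> v = 0} = orth a b"
      using v by (auto simp: orth_def inner_add_right inner_diff_right)
    ultimately show ?thesis by simp
  qed
  define u where "u i = y i \<bullet> e" for i
  define w where "w i = y i \<bullet> e'" for i
  define Z where "Z = {i. i < n \<and> u i = 0 \<and> w i = 0}"
  define J where "J = {i. i < n \<and> (u i, w i) \<noteq> (0, 0)}"
  have orth_eq: "orth a b = {i. i < n \<and> a * u i + b * w i = 0}" for a b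
    by (auto simp: orth_def u_def w_def inner_add_right)
  have Z_affine: "affine_on_AE \<Omega> (\<lambda>x. \<Sum>i\<in>Z. g i x)"
  proof -
    \<comment> \<open>A generic direction \<open>e + b *\<^sub>R e'\<close> isolates
      \<open>Z\<close>: each node with nonzero \<open>w i\<close> rules out a single
      \<open>b\<close>. If \<open>w i = 0\<close>, the orthogonality equation already gives
      \<open>u i = 0\<close>, and the value 0 of the quotient is excluded harmlessly.\<close>
    have "finite ((\<lambda>i. - u i / w i) ` {..<n})"
      by simp
    then obtain b where b: "b \<notin> (\<lambda>i. - u i / w i) ` {..<n}"
      using ex_new_if_finite[OF infinite_UNIV_char_0] by blast
    have "u i = 0 \<and> w i = 0" if "i < n" "u i + b * w i = 0" for i
    proof (cases "w i = 0")
      case False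
      with that have "b = - u i / w i"
        by (simp add: field_simps)
      with b that show ?thesis by blast
    qed (use that in auto)
    then have "orth 1 b = Z"
      by (auto simp: orth_eq Z_def)
    then show ?thesis
      using orth_affine[of 1 b] by simp
  qed
  \<comment> \<open>The determinant condition says that the pairs of \<open>i\<close> and
    \<open>j\<close> span the same line.\<close>
  define cls where "cls i = {j \<in> J. w i * u j - u i * w j = 0}" for i
  have cls_affine: "affine_on_AE \<Omega> (\<lambda>x. \<Sum>j\<in>cls i. g j x)" if "i \<in> J" for i
  proof -
    \<comment> \<open>The coefficients \<open>w i\<close> and \<open>- u i\<close> give the
      direction orthogonal to \<open>y i\<close>; the nodes orthogonal to it are those of the class
      together with \<open>Z\<close>, whose sum is already known to be affine.\<close>
    have eq: "orth (w i) (- u i) = Z \<union> cls i" "Z \<inter> cls i = {}" "finite Z" "finite (cls i)"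
      by (auto simp: orth_eq Z_def cls_def J_def)
    have "(\<Sum>j\<in>orth (w i) (- u i). g j x) - (\<Sum>j\<in>Z. g j x) = (\<Sum>j\<in>cls i. g j x)" for x
      unfolding eq(1) using eq by (simp add: sum.union_disjoint)
    with affine_on_AE_diff[OF orth_affine[of "w i" "- u i"] Z_affine] that show ?thesis
      by (auto simp: J_def)
  qed
  have cls_iff: "cls j = cls i \<longleftrightarrow> j \<in> cls i" if "i \<in> J" "j \<in> J" for i j
  proof
    assume "cls j = cls i"
    moreover have "j \<in> cls j"
      using that by (simp add: cls_def)
    ultimately show "j \<in> cls i" by simp
  next
    assume "j \<in> cls i"
    then have ij: "w i * u j = u i * w j"
      by (simp add: cls_def)
    have "w j * u m = u j * w m \<longleftrightarrow> w i * u m = u i * w m" for m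
    \<comment> \<open>Both pairs are nonzero, so the two identities transfer the vanishing of either
      determinant to the other.\<close>
    proof -
      have "u i * (w j * u m - u j * w m) = u j * (w i * u m - u i * w m)"
        "w i * (w j * u m - u j * w m) = w j * (w i * u m - u i * w m)"
        using ij by algebra+
      then show ?thesis
        using that by (auto simp: J_def)
    qed
    then show "cls j = cls i"
      by (simp add: cls_def)
  qed
  have "f x = (\<Sum>i\<in>Z. g i x) + (\<Sum>S\<in>cls ` J. \<Sum>j\<in>S. g j x)" for x
  proof -
    have "{..<n} = Z \<union> J" "Z \<inter> J = {}" "finite Z" "finite J"
      by (auto simp: Z_def J_def)
    then have "f x = (\<Sum>i\<in>Z. g i x) + (\<Sum>j\<in>J. g j x)"
      unfolding f_eq g_def by (simp add: sum.union_disjoint)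
    also have "(\<Sum>j\<in>J. g j x) = (\<Sum>S\<in>cls ` J. \<Sum>j\<in>{j \<in> J. cls j = S}. g j x)"
      using \<open>finite J\<close> by (rule sum.image_gen)
    also have "\<dots> = (\<Sum>S\<in>cls ` J. \<Sum>j\<in>S. g j x)"
    proof (rule sum.cong[OF refl])
      fix S assume "S \<in> cls ` J"
      then obtain i where "i \<in> J" "S = cls i" by blast
      then have "{j \<in> J. cls j = S} = S"
        using cls_iff by (auto simp: cls_def)
      then show "(\<Sum>j | j \<in> J \<and> cls j = S. g j x) = (\<Sum>j\<in>S. g j x)" by simp
    qed
    finally show ?thesis .
  qed
  then have "f = (\<lambda>x. (\<Sum>i\<in>Z. g i x) + (\<Sum>S\<in>cls ` J. \<Sum>j\<in>S. g j x))"
    by blast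
  moreover have "affine_on_AE \<Omega> (\<lambda>x. (\<Sum>i\<in>Z. g i x) + (\<Sum>S\<in>cls ` J. \<Sum>j\<in>S. g j x))"
    by (intro affine_on_AE_add affine_on_AE_sum[of "cls ` J"] Z_affine) (auto intro: cls_affine)
  ultimately have "affine_on_AE \<Omega> f"
    by simp
  moreover obtain v where "recession_vector \<Omega> v"
    using plane[of 1 0] by auto
  ultimately show ?thesis
    using affine_on_AE_Lp_fun_eq_0[OF f(2) _ \<Omega> _ p] by blast
qed

text \<open>Functions equal almost everywhere on \<Omega> have the same class; the empty network
  shows that the zero class does occur.\<close>

lemma nets_in_Lp_trivial:
  fixes \<Omega> :: "'a::euclidean_space set"
  assumes \<phi>: "asymp_affine \<phi>" and \<Omega>: "\<Omega> \<in> sets lebesgue" and p: "0 < p"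
    and plane: "\<And>a b. (a, b) \<noteq> (0, 0) \<Longrightarrow>
      recession_vector \<Omega> (a *\<^sub>R e + b *\<^sub>R e') \<or> recession_vector \<Omega> (- (a *\<^sub>R e + b *\<^sub>R e'))"
  shows "nets_in_Lp \<phi> p \<Omega> = {Lp_class p \<Omega> (\<lambda>_. 0)}"
proof -
  have "Lp_class p \<Omega> f = Lp_class p \<Omega> (\<lambda>_. 0)" if "f \<in> shallow_nets \<phi>" "f \<in> Lp_fun p \<Omega>" for f
  proof -
    have "AE x in lebesgue. x \<in> \<Omega> \<longrightarrow> f x = 0"
      using shallow_net_in_Lp_eq_0[OF that \<phi> \<Omega> p plane] .
    then have ae: "AE x in lebesgue_on \<Omega>. f x = 0"
      using \<Omega> by (simp add: AE_restrict_space_iff)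
    have "(AE x in lebesgue_on \<Omega>. g x = f x) \<longleftrightarrow> (AE x in lebesgue_on \<Omega>. g x = 0)" for g
      by (rule eventually_subst) (use ae in \<open>auto elim!: eventually_mono\<close>)
    then show ?thesis
      by (simp add: Lp_class_def)
  qed
  moreover have "(\<lambda>_. 0) \<in> shallow_nets \<phi>"
    unfolding shallow_nets_def by (auto intro!: exI[of _ 0])
  moreover have "(\<lambda>_. 0) \<in> Lp_fun p \<Omega>"
    by (simp add: Lp_fun_def)
  ultimately show ?thesis
    unfolding nets_in_Lp_def by blast
qed

section \<open>The activation functions and the domains\<close>

lemma sigmoid_asymp_affine:
  assumes "sigmoid \<phi>"
  shows "asymp_affine \<phi>"
proof -
  have "((\<lambda>t. \<phi> t - (0 * t + 1)) \<longlongrightarrow> 0) at_top" "((\<lambda>t. \<phi> t - (0 * t + 0)) \<longlongrightarrow> 0) at_bot"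
    using assms by (auto simp: sigmoid_def LIM_zero)
  then show ?thesis
    unfolding asymp_affine_def by blast
qed

lemma leaky_relu_asymp_affine: "asymp_affine (leaky_relu \<alpha>)"
proof -
  have "\<forall>\<^sub>F t in at_top. leaky_relu \<alpha> t - (1 * t + 0) = 0"
    using eventually_gt_at_top[of 0] by eventually_elim (simp add: leaky_relu_def)
  then have "((\<lambda>t. leaky_relu \<alpha> t - (1 * t + 0)) \<longlongrightarrow> 0) at_top"
    by (rule tendsto_eventually)
  moreover have "\<forall>\<^sub>F t in at_bot. leaky_relu \<alpha> t - (\<alpha> * t + 0) = 0"
    using eventually_le_at_bot[of 0] by eventually_elim (simp add: leaky_relu_def)
  then have "((\<lambda>t. leaky_relu \<alpha> t - (\<alpha> * t + 0)) \<longlongrightarrow> 0) at_bot"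
    by (rule tendsto_eventually)
  ultimately show ?thesis
    unfolding asymp_affine_def by blast
qed

lemma relu_eq_leaky_relu: "relu = leaky_relu 0"
  by (auto simp: relu_def leaky_relu_def)

lemma elu_asymp_affine: "asymp_affine (elu \<alpha>)"
proof -
  have "\<forall>\<^sub>F t in at_top. elu \<alpha> t - (1 * t + 0) = 0"
    using eventually_gt_at_top[of 0] by eventually_elim (simp add: elu_def)
  then have "((\<lambda>t. elu \<alpha> t - (1 * t + 0)) \<longlongrightarrow> 0) at_top"
    by (rule tendsto_eventually)
  moreover have "\<forall>\<^sub>F t in at_bot. \<alpha> * exp t = elu \<alpha> t - (0 * t + - \<alpha>)"
    using eventually_le_at_bot[of 0] by eventually_elim (simp add: elu_def algebra_simps)
  then have "((\<lambda>t. elu \<alpha> t - (0 * t + - \<alpha>)) \<longlongrightarrow> 0) at_bot"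
    by (rule Lim_transform_eventually[rotated]) (intro tendsto_mult_right_zero exp_at_bot)
  ultimately show ?thesis
    unfolding asymp_affine_def by blast
qed

lemma softplus_asymp_affine: "asymp_affine softplus"
proof -
  have "((\<lambda>t. softplus t - (1 * t + 0)) \<longlongrightarrow> 0) at_top"
    "((\<lambda>t. softplus t - (0 * t + 0)) \<longlongrightarrow> 0) at_bot"
    unfolding softplus_def by real_asymp+
  then show ?thesis
    unfolding asymp_affine_def by blast
qed

section \<open>Recession vectors and measurability of the three domains\<close>

lemma recession_vector_UNIV: "v \<noteq> 0 \<Longrightarrow> recession_vector UNIV v"
  by (simp add: recession_vector_def)

lemma recession_vector_strip:
  "v \<noteq> 0 \<Longrightarrow> recession_vector (strip :: ((real ^ 2) \<times> (real ^ 'n)) set) (v, 0)"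
  by (auto simp: recession_vector_def strip_def zero_prod_def)

lemma closed_strip: "closed (strip :: ((real ^ 2) \<times> (real ^ 'n)) set)"
proof -
  have "closed {x :: real ^ 'n. \<forall>i. 0 \<le> x $ i \<and> x $ i \<le> 1}"
    by (intro closed_Collect_all closed_Collect_conj closed_Collect_le continuous_intros)
  then show ?thesis
    unfolding strip_def by (intro closed_Times) auto
qed

lemma paraboloid_exterior_eq:
  "paraboloid_exterior = {z :: real \<times> (real ^ 'n). fst z < snd z \<bullet> snd z}"
  by (auto simp: paraboloid_exterior_def inner_vec_def power2_eq_square)

lemma open_paraboloid_exterior: "open (paraboloid_exterior :: (real \<times> (real ^ 'n)) set)"
  unfolding paraboloid_exterior_eq by (intro open_Collect_less continuous_intros)

text \<open>For nonzero \<open>v\<close> the squared norm grows quadratically in \<open>k\<close>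
  and beats the linear first coordinate. For \<open>v = 0\<close> the squared norm is constant, and
  the first coordinate must decrease.\<close>

lemma recession_vector_paraboloid_exterior:
  fixes v :: "real ^ 'n"
  assumes "v \<noteq> 0 \<or> a < 0"
  shows "recession_vector paraboloid_exterior (a, v)"
  unfolding recession_vector_def
proof (intro conjI ballI)
  show "(a, v) \<noteq> 0"
    using assms by (auto simp: zero_prod_def)
next
  fix z :: "real \<times> (real ^ 'n)"
  assume z: "z \<in> paraboloid_exterior"
  obtain z0 z' where z_eq: "z = (z0, z')"
    by (cases z)
  define q where "q = v \<bullet> v"
  define r where "r = v \<bullet> z'"
  define s where "s = z' \<bullet> z'"
  have "\<forall>\<^sub>F k in sequentially. z0 + real k * a < s + 2 * real k * r + (real k)\<^sup>2 * q"
  proof (cases "v = 0")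
    case True
    have "z0 < s"
      using z by (simp add: paraboloid_exterior_eq z_eq s_def)
    moreover have "real k * a \<le> 0" for k
      using True assms by (simp add: mult_nonneg_nonpos)
    ultimately have "z0 + real k * a < s" for k
      by (smt (verit))
    with True show ?thesis
      by (simp add: q_def r_def)
  next
    case False
    then have "q > 0"
      by (simp add: q_def)
    then show ?thesis
      by real_asymp
  qed
  then show "\<forall>\<^sub>F k in sequentially. z + real k *\<^sub>R (a, v) \<in> paraboloid_exterior"
    by (rule eventually_mono)
      (simp add: paraboloid_exterior_eq z_eq q_def r_def s_def inner_add_left inner_add_right
        inner_commute power2_eq_square algebra_simps)
qed

theorem corollary4p7:
  fixes \<phi> :: "real \<Rightarrow> real" and p :: real
  assumes "sigmoid \<phi> \<or> \<phi> = relu \<or> (\<exists>\<alpha>. \<phi> = elu \<alpha>) \<or> \<phi> = softplus \<or>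
           (\<exists>\<alpha>. \<alpha> \<noteq> 1 \<and> \<phi> = leaky_relu \<alpha>)"
    and "1 \<le> p"
  shows "nets_in_Lp \<phi> p (strip :: ((real ^ 2) \<times> (real ^ 'n)) set)
           = {Lp_class p strip (\<lambda>_. 0)} \<and>
         nets_in_Lp \<phi> p (UNIV :: (real \<times> (real ^ 'n)) set)
           = {Lp_class p UNIV (\<lambda>_. 0)} \<and>
         nets_in_Lp \<phi> p (paraboloid_exterior :: (real \<times> (real ^ 'n)) set)
           = {Lp_class p paraboloid_exterior (\<lambda>_. 0)}"
proof -
  have \<phi>: "asymp_affine \<phi>"
    using assms(1) sigmoid_asymp_affine leaky_relu_asymp_affine elu_asymp_affine
      softplus_asymp_affine by (auto simp: relu_eq_leaky_relu)
  have p: "0 < p"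
    using assms(2) by simp
  have "nets_in_Lp \<phi> p (strip :: ((real ^ 2) \<times> (real ^ 'n)) set) = {Lp_class p strip (\<lambda>_. 0)}"
  \<comment> \<open>The plane is the unbounded factor of the strip.\<close>
  proof (rule nets_in_Lp_trivial[OF \<phi> _ p, where e = "(axis 1 1, 0)" and e' = "(axis 2 1, 0)"])
    show "(strip :: ((real ^ 2) \<times> (real ^ 'n)) set) \<in> sets lebesgue"
      by (simp add: borel_closed closed_strip)
    fix a b :: real
    assume "(a, b) \<noteq> (0, 0)"
    then have "a *\<^sub>R axis 1 1 + b *\<^sub>R axis 2 1 \<noteq> (0 :: real ^ 2)"
      by (auto simp: vec_eq_iff forall_2 axis_def)
    from recession_vector_strip[OF this, where 'n = 'n]
    show "recession_vector strip
          (a *\<^sub>R (axis 1 1, 0) + b *\<^sub>R (axis 2 1 :: real ^ 2, 0 :: real ^ 'n)) \<or>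
        recession_vector strip
          (- (a *\<^sub>R (axis 1 1, 0) + b *\<^sub>R (axis 2 1 :: real ^ 2, 0 :: real ^ 'n)))"
      by simp
  qed
  moreover have "nets_in_Lp \<phi> p (UNIV :: (real \<times> (real ^ 'n)) set) = {Lp_class p UNIV (\<lambda>_. 0)}"
  \<comment> \<open>The index \<open>undefined\<close> stands for an arbitrary coordinate of the
    second factor; any two independent vectors would serve here.\<close>
  proof (rule nets_in_Lp_trivial[OF \<phi> _ p, where e = "(1, 0)" and e' = "(0, axis undefined 1)"])
    fix a b :: real
    assume "(a, b) \<noteq> (0, 0)"
    then have "a *\<^sub>R (1, 0) + b *\<^sub>R (0, axis undefined 1) \<noteq> (0 :: real \<times> (real ^ 'n))"
      by (auto simp: zero_prod_def axis_eq_0_iff)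
    then show "recession_vector UNIV
          (a *\<^sub>R (1, 0) + b *\<^sub>R (0 :: real, axis undefined 1 :: real ^ 'n)) \<or>
        recession_vector UNIV
          (- (a *\<^sub>R (1, 0) + b *\<^sub>R (0 :: real, axis undefined 1 :: real ^ 'n)))"
      by (blast intro: recession_vector_UNIV)
  qed simp
  moreover have "nets_in_Lp \<phi> p (paraboloid_exterior :: (real \<times> (real ^ 'n)) set)
      = {Lp_class p paraboloid_exterior (\<lambda>_. 0)}"
  proof (rule nets_in_Lp_trivial[OF \<phi> _ p, where e = "(1, 0)" and e' = "(0, axis undefined 1)"])
    show "(paraboloid_exterior :: (real \<times> (real ^ 'n)) set) \<in> sets lebesgue"
      by (simp add: borel_open open_paraboloid_exterior)
    fix a b :: real
    assume "(a, b) \<noteq> (0, 0)"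
    \<comment> \<open>The freedom of sign is needed when \<open>b = 0\<close>: only the negative
      multiples of the first axis are recession vectors.\<close>
    then have "b *\<^sub>R axis undefined 1 \<noteq> (0 :: real ^ 'n) \<or> a < 0 \<or> - a < 0"
      by (auto simp: axis_eq_0_iff)
    then show "recession_vector paraboloid_exterior
          (a *\<^sub>R (1, 0) + b *\<^sub>R (0, axis undefined 1 :: real ^ 'n)) \<or>
        recession_vector paraboloid_exterior
          (- (a *\<^sub>R (1, 0) + b *\<^sub>R (0, axis undefined 1 :: real ^ 'n)))"
      using recession_vector_paraboloid_exterior[of "b *\<^sub>R axis undefined 1 :: real ^ 'n" a]
        recession_vector_paraboloid_exterior[of "- (b *\<^sub>R axis undefined 1 :: real ^ 'n)" "- a"]
      by auto
  qed
  ultimately show ?thesis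
    by blast
qed

end
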